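(* Let $n\geq 3$ and let $G$ be an edge-colored complete 3-partite 3-graph $K^{(3)}_{n,n,n}$ with partite sets $V_1,V_2,V_3$, containing no rainbow copy of $\mathcal{T}$, with $k=|C(G)|\geq 3$. Then at least one of the following holds: (i) for some $\ell\in[3]$, the set $V_\ell$ can be partitioned into $k$ parts $V_{\ell,1},\ldots,V_{\ell,k}$ such that (with colors numbered $1,\ldots,k$) for each $i\in[k]$ all edges containing a vertex of $V_{\ell,i}$ have color $i$; (ii) after renumbering the colors as $1,\ldots,k$ if necessary, for every $\ell\in[3]$ the set $V_\ell$ can be partitioned into $k-1$ parts $V_{\ell,2},\ldots,V_{\ell,k}$ such that for every $i\in\{2,\ldots,k\}$ all edges contained in $V_{1,i}\cup V_{2,i}\cup V_{3,i}$ have color $1$ or $i$, and all remaining edges have color $1$.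
   Context: $K^{(3)}_{n,n,n}$ with partite sets $V_1,V_2,V_3$ (disjoint, each of size $n$) is the 3-graph whose edges are all sets $\{x,y,z\}$ with $x\in V_1,y\in V_2,z\in V_3$. An edge-coloring is any map $c$ from edges to colors; $C(G)$ is the set of colors used; a copy is rainbow if its edges have pairwise distinct colors. The tight path $\mathcal{T}$ is the 3-graph with edges $\{v_1v_2v_3,v_2v_3v_4,v_3v_4v_5\}$. *)

theory Defs
  imports Main "HOL-Library.Disjoint_Sets"
begin

text \<open>
  A 3-graph without isolated vertices is represented by its set of edges, and an edge-coloring
  by a function on vertex sets of which only the values on edges matter.
\<close>

definition complete_3partite :: "(nat \<Rightarrow> 'a set) \<Rightarrow> 'a set set" where
  "complete_3partite V = {{x, y, z} | x y z. x \<in> V 1 \<and> y \<in> V 2 \<and> z \<in> V 3}"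

definition colors_used :: "('a set \<Rightarrow> 'c) \<Rightarrow> 'a set set \<Rightarrow> 'c set" where
  "colors_used c E = c ` E"

definition tight_path :: "nat set set" where
  "tight_path = {{1, 2, 3}, {2, 3, 4}, {3, 4, 5}}"

definition is_copy :: "'v set set \<Rightarrow> 'a set set \<Rightarrow> bool" where
  "is_copy H F \<longleftrightarrow> (\<exists>f. inj_on f (\<Union>H) \<and> F = (`) f ` H)"

definition rainbow :: "('a set \<Rightarrow> 'c) \<Rightarrow> 'a set set \<Rightarrow> bool" where
  "rainbow c F \<longleftrightarrow> (\<forall>e\<in>F. \<forall>e'\<in>F. e \<noteq> e' \<longrightarrow> c e \<noteq> c e')"

definition contains_rainbow_copy ::
    "('a set \<Rightarrow> 'c) \<Rightarrow> 'a set set \<Rightarrow> 'v set set \<Rightarrow> bool" where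
  "contains_rainbow_copy c E H \<longleftrightarrow> (\<exists>F \<subseteq> E. is_copy H F \<and> rainbow c F)"

definition indexed_partition :: "'i set \<Rightarrow> ('i \<Rightarrow> 'a set) \<Rightarrow> 'a set \<Rightarrow> bool" where
  "indexed_partition I P A \<longleftrightarrow>
     disjoint_family_on P I \<and> (\<Union>i\<in>I. P i) = A \<and> (\<forall>i\<in>I. P i \<noteq> {})"

end

theory Submission
  imports Defs
begin

text \<open>
  Write \<open>f x y z\<close> for the color of \<open>{x, y, z}\<close>. The absence of a rainbow tight path says that in
  every axis-parallel plane of the cube \<open>V\<^sub>1 \<times> V\<^sub>2 \<times> V\<^sub>3\<close>, a cell, a cell in its row and a cell
  in its column never have three different colors. If some line carries three colors, then the
  lines crossing it are monochromatic, and propagating this shows that \<open>f\<close> depends on one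
  coordinate only. Otherwise every line, and then every plane, carries at most two colors. Take a
  line with two colors \<open>a \<noteq> b\<close>. The planes through a cell of a third color \<open>d\<close> meet
  the planes through the line, which forces them to be colored by \<open>{s, d}\<close> with \<open>s \<in> {a, b}\<close>, and
  \<open>s\<close> is the same for all such cells. Hence cells of different colors other than \<open>s\<close> have no
  coordinate in common.
\<close>

section \<open>Colorings of planes and of the cube\<close>

definition corner_free :: "'a set \<Rightarrow> 'b set \<Rightarrow> ('a \<Rightarrow> 'b \<Rightarrow> 'c) \<Rightarrow> bool" where
  "corner_free A B M \<longleftrightarrow>
     (\<forall>x\<in>A. \<forall>x'\<in>A. \<forall>y\<in>B. \<forall>y'\<in>B. \<not> distinct [M x y, M x' y, M x y'])"

definition bicolored :: "'a set \<Rightarrow> 'b set \<Rightarrow> ('a \<Rightarrow> 'b \<Rightarrow> 'c) \<Rightarrow> bool" where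
  "bicolored A B M \<longleftrightarrow>
     (\<forall>x\<in>A. \<forall>x'\<in>A. \<forall>x''\<in>A. \<forall>y\<in>B. \<forall>y'\<in>B. \<forall>y''\<in>B.
        \<not> distinct [M x y, M x' y', M x'' y''])"

text \<open>\<open>s\<close> is the color that becomes color 1 in alternative (ii). Any two other
  colors occupy disjoint sets of coordinates in each direction, which is what keeps the blocks
  apart.\<close>

definition separating ::
    "'a set \<Rightarrow> 'b set \<Rightarrow> 'd set \<Rightarrow> ('a \<Rightarrow> 'b \<Rightarrow> 'd \<Rightarrow> 'c) \<Rightarrow> 'c \<Rightarrow> bool" where
  "separating A B C f s \<longleftrightarrow>
     (\<forall>x\<in>A. \<forall>x'\<in>A. \<forall>y\<in>B. \<forall>y'\<in>B. \<forall>z\<in>C. \<forall>z'\<in>C.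
        f x y z \<noteq> s \<longrightarrow> f x' y' z' \<noteq> s \<longrightarrow> f x y z \<noteq> f x' y' z' \<longrightarrow>
        x \<noteq> x' \<and> y \<noteq> y' \<and> z \<noteq> z')"

lemma corner_free_swap: "corner_free A B M \<Longrightarrow> corner_free B A (\<lambda>y x. M x y)"
  unfolding corner_free_def by fastforce

lemma bicolored_swap: "bicolored A B M \<Longrightarrow> bicolored B A (\<lambda>y x. M x y)"
  unfolding bicolored_def by blast

lemma separatingD:
  assumes "separating A B C f s" "x \<in> A" "x' \<in> A" "y \<in> B" "y' \<in> B" "z \<in> C" "z' \<in> C"
    and "f x y z \<noteq> s" "f x' y' z' \<noteq> s" "f x y z \<noteq> f x' y' z'"
  shows "x \<noteq> x' \<and> y \<noteq> y' \<and> z \<noteq> z'"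
  using assms(1)[unfolded separating_def, rule_format, OF assms(2-)] .

lemma separating_swap:
  assumes "separating B A C (\<lambda>y x z. f x y z) s" shows "separating A B C f s"
  using separatingD[OF assms] unfolding separating_def by simp

lemma separating_rotate:
  assumes "separating C A B (\<lambda>z x y. f x y z) s" shows "separating A B C f s"
  using separatingD[OF assms] unfolding separating_def by simp

text \<open>If \<open>M x y\<close> differed from \<open>M x y0\<close>, the corner at
  \<open>(x, y0)\<close> would leave only these two colors for every cell \<open>(w, y0)\<close>,
  while that line carries three.\<close>

lemma corner_free_rainbow_line:
  assumes "corner_free A B M" "x1 \<in> A" "x2 \<in> A" "x3 \<in> A" "y0 \<in> B"
    and "distinct [M x1 y0, M x2 y0, M x3 y0]" and "x \<in> A" "y \<in> B"
  shows "M x y = M x y0"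
proof (rule ccontr)
  assume ne: "M x y \<noteq> M x y0"
  have "M w y0 = M x y0 \<or> M w y0 = M x y" if "w \<in> A" for w
    using assms(1,5,7,8) that ne unfolding corner_free_def by fastforce
  from this[OF assms(2)] this[OF assms(3)] this[OF assms(4)] assms(6)
  show False by auto
qed

text \<open>If a line in the first direction carries two colors, corners at its cells pass this pair
  of colors on to all lines crossing it. If there is no such line, \<open>M\<close> depends on the
  second coordinate only, and a single crossing line shows all colors.\<close>

lemma bicolored_if_lines_bicolored:
  assumes cf: "corner_free A B M"
    and rows: "\<And>x y y' y''. \<lbrakk>x \<in> A; y \<in> B; y' \<in> B; y'' \<in> B\<rbrakk> \<Longrightarrow> \<not> distinct [M x y, M x y', M x y'']"
    and cols: "\<And>x x' x'' y. \<lbrakk>x \<in> A; x' \<in> A; x'' \<in> A; y \<in> B\<rbrakk> \<Longrightarrow> \<not> distinct [M x y, M x' y, M x'' y]"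
  shows "bicolored A B M"
proof (cases "\<exists>x1\<in>A. \<exists>x2\<in>A. \<exists>y\<in>B. M x1 y \<noteq> M x2 y")
  case True
  then obtain x1 x2 y where h: "x1 \<in> A" "x2 \<in> A" "y \<in> B" "M x1 y \<noteq> M x2 y" by blast
  have two: "M x y' = M x1 y \<or> M x y' = M x2 y" if "x \<in> A" "y' \<in> B" for x y'
  proof -
    have "M x y = M x1 y \<or> M x y = M x2 y" using cols[of x1 x2 x y] h that by auto
    \<comment> \<open>Whichever of the two colors \<open>M x y\<close> has, the corner using the
      cell with the other one confines \<open>M x y'\<close> to the pair.\<close>
    moreover have "\<not> distinct [M x y, M x1 y, M x y']" "\<not> distinct [M x y, M x2 y, M x y']"
      using cf h that unfolding corner_free_def by blast+
    ultimately show ?thesis using h(4) by auto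
  qed
  show ?thesis unfolding bicolored_def using two by (simp, metis)
next
  case False
  then have const: "M x y = M x' y" if "x \<in> A" "x' \<in> A" "y \<in> B" for x x' y using that by blast
  show ?thesis
    unfolding bicolored_def
  proof (intro ballI)
    fix x x' x'' y y' y''
    assume h: "x \<in> A" "x' \<in> A" "x'' \<in> A" "y \<in> B" "y' \<in> B" "y'' \<in> B"
    show "\<not> distinct [M x y, M x' y', M x'' y'']"
      using rows[of x y y' y''] const[of x' x y'] const[of x'' x y''] h by simp
  qed
qed

text \<open>The two coordinate planes through the line use only its two colors. They meet the planes
  through any cell of a third color, and at the intersections the second color of those planes can
  be read off.\<close>

lemma separating_color_of_bicolored_line:
  fixes f :: "'a \<Rightarrow> 'b \<Rightarrow> 'd \<Rightarrow> 'c"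
  assumes XY: "\<And>z. z \<in> C \<Longrightarrow> bicolored A B (\<lambda>x y. f x y z)"
    and XZ: "\<And>y. y \<in> B \<Longrightarrow> bicolored A C (\<lambda>x z. f x y z)"
    and YZ: "\<And>x. x \<in> A \<Longrightarrow> bicolored B C (f x)"
    and line: "x1 \<in> A" "x2 \<in> A" "y \<in> B" "z \<in> C" "f x1 y z \<noteq> f x2 y z"
    and third: "x3 \<in> A" "y3 \<in> B" "z3 \<in> C" "f x3 y3 z3 \<notin> {f x1 y z, f x2 y z}"
  shows "\<exists>s\<in>{f x1 y z, f x2 y z}. separating A B C f s"
proof -
  define a b where "a = f x1 y z" and "b = f x2 y z"
  have ab: "a \<noteq> b" using line by (simp add: a_def b_def)
  have planeZ: "f u v z \<in> {a, b}" if "u \<in> A" "v \<in> B" for u v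
    using XY[OF line(4)] line that unfolding bicolored_def a_def b_def by fastforce
  have planeY: "f u y w \<in> {a, b}" if "u \<in> A" "w \<in> C" for u w
    using XZ[OF line(3)] line that unfolding bicolored_def a_def b_def by fastforce
  \<comment> \<open>The cross of a cell is the union of the three planes through it.\<close>
  define cross where "cross s u v w \<longleftrightarrow>
      (\<forall>u'\<in>A. \<forall>v'\<in>B. \<forall>w'\<in>C. (u' = u \<or> v' = v \<or> w' = w) \<longrightarrow> f u' v' w' \<in> {s, f u v w})"
    for s u v w
  have crossD: "f u' v' w' = s \<or> f u' v' w' = f u v w"
    if "cross s u v w" "u' \<in> A" "v' \<in> B" "w' \<in> C" "u' = u \<or> v' = v \<or> w' = w"
    for s u v w u' v' w'
    using that(1)[unfolded cross_def, rule_format, OF that(2-5)] by simp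
  \<comment> \<open>At \<open>(u, y, z)\<close> the plane with first coordinate \<open>u\<close>
    meets the line. Its color spreads to the other two planes through \<open>(u, v, z)\<close> and
    \<open>(u, y, w)\<close>: both lie in the first plane and in a plane through the line, so
    neither has the color of \<open>(u, v, w)\<close>.\<close>
  have cross: "cross (f u y z) u v w"
    if "u \<in> A" "v \<in> B" "w \<in> C" "f u v w \<notin> {a, b}" for u v w
  proof -
    note ins = that(1-3) line(3,4)
    have s: "f u y z \<in> {a, b}" using planeZ ins by blast
    have px: "f u v' w' \<in> {f u y z, f u v w}" if "v' \<in> B" "w' \<in> C" for v' w'
    proof -
      have "\<not> distinct [f u y z, f u v w, f u v' w']"
        using YZ[OF ins(1)] ins that unfolding bicolored_def by blast
      then show ?thesis using s \<open>f u v w \<notin> {a, b}\<close> by auto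
    qed
    have "f u v z = f u y z" using px[of v z] planeZ[of u v] ins \<open>f u v w \<notin> {a, b}\<close> by auto
    have py: "f u' v w' \<in> {f u y z, f u v w}" if "u' \<in> A" "w' \<in> C" for u' w'
    proof -
      have "\<not> distinct [f u v z, f u v w, f u' v w']"
        using XZ[OF ins(2)] ins that unfolding bicolored_def by blast
      then show ?thesis using s \<open>f u v z = f u y z\<close> \<open>f u v w \<notin> {a, b}\<close> by auto
    qed
    have "f u y w = f u y z" using px[of y w] planeY[of u w] ins \<open>f u v w \<notin> {a, b}\<close> by auto
    have pz: "f u' v' w \<in> {f u y z, f u v w}" if "u' \<in> A" "v' \<in> B" for u' v'
    proof -
      have "\<not> distinct [f u y w, f u v w, f u' v' w]"
        using XY[OF ins(3)] ins that unfolding bicolored_def by blast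
      then show ?thesis using s \<open>f u y w = f u y z\<close> \<open>f u v w \<notin> {a, b}\<close> by auto
    qed
    show ?thesis unfolding cross_def using px py pz by blast
  qed
  have third': "f x3 y3 z3 \<notin> {a, b}" using third by (simp add: a_def b_def)
  define s where "s = f x3 y z"
  have s: "s \<in> {a, b}" using planeZ third line unfolding s_def by blast
  \<comment> \<open>The cell \<open>(x3, v, z)\<close> lies on the crosses of
    \<open>(u, v, w)\<close> and \<open>(x3, y3, z3)\<close> and in a plane through the line. Its
    color is therefore in \<open>{a, b}\<close> and must be the second color of both
    crosses.\<close>
  have cross_s: "cross s u v w"
    if "u \<in> A" "v \<in> B" "w \<in> C" "f u v w \<notin> {a, b}" for u v w
  proof -
    have "f x3 v z \<in> {f u y z, f u v w}"
      using crossD[OF cross[OF that], of x3 v z] third line that by simp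
    moreover have "f x3 v z \<in> {s, f x3 y3 z3}"
      using crossD[OF cross[OF third(1-3) third'], of x3 v z] third line that
      unfolding s_def by simp
    moreover have "f x3 v z \<in> {a, b}" using planeZ third that by blast
    ultimately have "f u y z = s" using third' that(4) by auto
    then show ?thesis using cross[OF that] by simp
  qed
  have "separating A B C f s"
    unfolding separating_def
  proof (intro ballI impI)
    fix u u' v v' w w'
    assume h: "u \<in> A" "u' \<in> A" "v \<in> B" "v' \<in> B" "w \<in> C" "w' \<in> C"
      and ne: "f u v w \<noteq> s" "f u' v' w' \<noteq> s" "f u v w \<noteq> f u' v' w'"
    \<comment> \<open>\<open>{a, b}\<close> contains only one color besides \<open>s\<close>, so two
      different colors other than \<open>s\<close> are not both in it. The cross of the cell outside
      the pair then excludes the other cell.\<close>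
    have "f u v w \<notin> {a, b} \<or> f u' v' w' \<notin> {a, b}" using ne s by auto
    then consider "f u v w \<notin> {a, b}" | "f u' v' w' \<notin> {a, b}" by blast
    then show "u \<noteq> u' \<and> v \<noteq> v' \<and> w \<noteq> w'"
    proof cases
      case 1
      then show ?thesis using crossD[OF cross_s[of u v w], of u' v' w'] h ne by metis
    next
      case 2
      then show ?thesis using crossD[OF cross_s[of u' v' w'], of u v w] h ne by metis
    qed
  qed
  then show ?thesis using s unfolding a_def b_def by blast
qed

text \<open>Two colors already force a line in some direction that is not monochromatic, and a third
  color exists besides any two on it. Permuting the coordinates reduces to lines in the first
  direction.\<close>

lemma separating_color_exists:
  fixes f :: "'a \<Rightarrow> 'b \<Rightarrow> 'd \<Rightarrow> 'c" and A :: "'a set" and B :: "'b set" and C :: "'d set"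
  defines "K \<equiv> {f x y z | x y z. x \<in> A \<and> y \<in> B \<and> z \<in> C}"
  assumes XY: "\<And>z. z \<in> C \<Longrightarrow> bicolored A B (\<lambda>x y. f x y z)"
    and XZ: "\<And>y. y \<in> B \<Longrightarrow> bicolored A C (\<lambda>x z. f x y z)"
    and YZ: "\<And>x. x \<in> A \<Longrightarrow> bicolored B C (f x)"
    and K: "card K \<ge> 3"
  shows "\<exists>s\<in>K. separating A B C f s"
proof -
  have K_I: "f x y z \<in> K" if "x \<in> A" "y \<in> B" "z \<in> C" for x y z
    using that unfolding K_def by blast
  have third: "\<exists>x\<in>A. \<exists>y\<in>B. \<exists>z\<in>C. f x y z \<notin> {p, q}" for p q
  proof (rule ccontr)
    assume "\<not> ?thesis"
    then have "K \<subseteq> {p, q}" unfolding K_def by blast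
    then have "card K \<le> card {p, q}" by (intro card_mono) auto
    also have "\<dots> \<le> 2" by (simp add: card_insert_if)
    finally show False using K by simp
  qed
  consider
      (x) x1 x2 y z where "x1 \<in> A" "x2 \<in> A" "y \<in> B" "z \<in> C" "f x1 y z \<noteq> f x2 y z"
    | (y) y1 y2 x z where "x \<in> A" "y1 \<in> B" "y2 \<in> B" "z \<in> C" "f x y1 z \<noteq> f x y2 z"
    | (z) z1 z2 x y where "x \<in> A" "y \<in> B" "z1 \<in> C" "z2 \<in> C" "f x y z1 \<noteq> f x y z2"
  proof -
    obtain p q r where p: "p \<in> A" "q \<in> B" "r \<in> C" using third by blast
    obtain u v w where u: "u \<in> A" "v \<in> B" "w \<in> C" "f u v w \<noteq> f p q r"
      using third[of "f p q r" "f p q r"] by blast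
    \<comment> \<open>Walk from \<open>(u, v, w)\<close> to \<open>(p, q, r)\<close> changing one
      coordinate at a time; the color changes at some step.\<close>
    have "f u v w \<noteq> f p v w \<or> f p v w \<noteq> f p q w \<or> f p q w \<noteq> f p q r" using u(4) by argo
    then show thesis
    proof (elim disjE)
      show thesis if "f u v w \<noteq> f p v w" by (rule x[OF u(1) p(1) u(2,3) that])
      show thesis if "f p v w \<noteq> f p q w" by (rule y[OF p(1) u(2) p(2) u(3) that])
      show thesis if "f p q w \<noteq> f p q r" by (rule z[OF p(1,2) u(3) p(3) that])
    qed
  qed
  then show ?thesis
  proof cases
    case x
    obtain x3 y3 z3 where "x3 \<in> A" "y3 \<in> B" "z3 \<in> C" "f x3 y3 z3 \<notin> {f x1 y z, f x2 y z}"
      using third by blast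
    from separating_color_of_bicolored_line[of C A B f, OF XY XZ YZ x this]
    show ?thesis using K_I[OF x(1,3,4)] K_I[OF x(2,3,4)] by auto
  next
    case y
    obtain x3 y3 z3 where "y3 \<in> B" "x3 \<in> A" "z3 \<in> C" "f x3 y3 z3 \<notin> {f x y1 z, f x y2 z}"
      using third by blast
    \<comment> \<open>The varying coordinate is moved to the front, and the planes are transposed to
      match.\<close>
    from separating_color_of_bicolored_line[of C B A "\<lambda>y x z. f x y z",
        OF bicolored_swap[OF XY] YZ XZ y(2,3,1,4,5) this]
    obtain s where "s \<in> {f x y1 z, f x y2 z}" "separating B A C (\<lambda>y x z. f x y z) s" by blast
    then show ?thesis using K_I[OF y(1,2,4)] K_I[OF y(1,3,4)] separating_swap[of B A C f s] by auto
  next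
    case z
    obtain x3 y3 z3 where "z3 \<in> C" "x3 \<in> A" "y3 \<in> B" "f x3 y3 z3 \<notin> {f x y z1, f x y z2}"
      using third by blast
    from separating_color_of_bicolored_line[of B C A "\<lambda>z x y. f x y z",
        OF bicolored_swap[OF XZ] bicolored_swap[OF YZ] XY z(3,4,1,2,5) this]
    obtain s where "s \<in> {f x y z1, f x y z2}" "separating C A B (\<lambda>z x y. f x y z) s" by blast
    then show ?thesis using K_I[OF z(1,2,3)] K_I[OF z(1,2,4)] separating_rotate[of C A B f s] by auto
  qed
qed

text \<open>A line with three colors makes the lines crossing it monochromatic in both planes
  through it. Its parallels in one plane then repeat its three colors, so the argument applies again
  to each of them.\<close>

lemma constant_across_rainbow_line:
  fixes f :: "'a \<Rightarrow> 'b \<Rightarrow> 'd \<Rightarrow> 'c"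
  assumes XY: "\<And>z. z \<in> C \<Longrightarrow> corner_free A B (\<lambda>x y. f x y z)"
    and XZ: "\<And>y. y \<in> B \<Longrightarrow> corner_free A C (\<lambda>x z. f x y z)"
    and line: "x1 \<in> A" "x2 \<in> A" "x3 \<in> A" "y0 \<in> B" "z0 \<in> C"
      "distinct [f x1 y0 z0, f x2 y0 z0, f x3 y0 z0]"
    and "x \<in> A" "y \<in> B" "z \<in> C"
  shows "f x y z = f x y0 z0"
proof -
  have Y: "f u y z0 = f u y0 z0" if "u \<in> A" for u
    using corner_free_rainbow_line[OF XY, of z0 x1 x2 x3 y0 u y] assms that by simp
  have "f x y z = f x y z0"
    using corner_free_rainbow_line[OF XZ, of y x1 x2 x3 z0 x z] assms Y by simp
  then show ?thesis using Y assms by simp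
qed

text \<open>A line with three colors makes \<open>f\<close> depend only on the coordinate in which
  it runs, which leads to (i). Without such lines all planes are bicolored and a separating color
  exists, which leads to (ii).\<close>

lemma coloring_dichotomy:
  fixes f :: "'a \<Rightarrow> 'b \<Rightarrow> 'd \<Rightarrow> 'c"
  assumes XY: "\<forall>z\<in>C. corner_free A B (\<lambda>x y. f x y z)"
    and XZ: "\<forall>y\<in>B. corner_free A C (\<lambda>x z. f x y z)"
    and YZ: "\<forall>x\<in>A. corner_free B C (f x)"
    and K: "card {f x y z | x y z. x \<in> A \<and> y \<in> B \<and> z \<in> C} \<ge> 3"
  obtains (fst) g where "\<forall>x\<in>A. \<forall>y\<in>B. \<forall>z\<in>C. f x y z = g x"
    | (snd) g where "\<forall>x\<in>A. \<forall>y\<in>B. \<forall>z\<in>C. f x y z = g y"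
    | (thd) g where "\<forall>x\<in>A. \<forall>y\<in>B. \<forall>z\<in>C. f x y z = g z"
    | (separating) s where "s \<in> {f x y z | x y z. x \<in> A \<and> y \<in> B \<and> z \<in> C}" "separating A B C f s"
proof -
  note XY = bspec[OF XY] and XZ = bspec[OF XZ] and YZ = bspec[OF YZ]
  consider
      (x) x1 x2 x3 y z where "x1 \<in> A" "x2 \<in> A" "x3 \<in> A" "y \<in> B" "z \<in> C"
        "distinct [f x1 y z, f x2 y z, f x3 y z]"
    | (y) y1 y2 y3 x z where "y1 \<in> B" "y2 \<in> B" "y3 \<in> B" "x \<in> A" "z \<in> C"
        "distinct [f x y1 z, f x y2 z, f x y3 z]"
    | (z) z1 z2 z3 x y where "z1 \<in> C" "z2 \<in> C" "z3 \<in> C" "x \<in> A" "y \<in> B"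
        "distinct [f x y z1, f x y z2, f x y z3]"
    | (none)
        "\<And>x x' x'' y z. \<lbrakk>x \<in> A; x' \<in> A; x'' \<in> A; y \<in> B; z \<in> C\<rbrakk> \<Longrightarrow>
          \<not> distinct [f x y z, f x' y z, f x'' y z]"
        "\<And>x y y' y'' z. \<lbrakk>x \<in> A; y \<in> B; y' \<in> B; y'' \<in> B; z \<in> C\<rbrakk> \<Longrightarrow>
          \<not> distinct [f x y z, f x y' z, f x y'' z]"
        "\<And>x y z z' z''. \<lbrakk>x \<in> A; y \<in> B; z \<in> C; z' \<in> C; z'' \<in> C\<rbrakk> \<Longrightarrow>
          \<not> distinct [f x y z, f x y z', f x y z'']"
    by blast
  then show thesis
  proof cases
    case x
    from constant_across_rainbow_line[of C A B f, OF XY XZ this]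
    show thesis by (intro fst[of "\<lambda>u. f u y z"]) blast
  next
    case y
    from constant_across_rainbow_line[of C B A "\<lambda>y x z. f x y z",
        OF corner_free_swap[OF XY] YZ y]
    show thesis by (intro snd[of "\<lambda>v. f x v z"]) blast
  next
    case z
    from constant_across_rainbow_line[of B C A "\<lambda>z x y. f x y z",
        OF corner_free_swap[OF XZ] corner_free_swap[OF YZ] z]
    show thesis by (intro thd[of "\<lambda>w. f x y w"]) blast
  next
    case none
    have "\<exists>s\<in>{f x y z | x y z. x \<in> A \<and> y \<in> B \<and> z \<in> C}. separating A B C f s"
    proof (rule separating_color_exists)
      show "bicolored A B (\<lambda>x y. f x y z)" if "z \<in> C" for z
        using bicolored_if_lines_bicolored[OF XY[OF that]] none that by blast
      show "bicolored A C (\<lambda>x z. f x y z)" if "y \<in> B" for y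
        using bicolored_if_lines_bicolored[OF XZ[OF that]] none that by blast
      show "bicolored B C (f x)" if "x \<in> A" for x
        using bicolored_if_lines_bicolored[OF YZ[OF that]] none that by blast
    qed (rule K)
    then show thesis using separating by blast
  qed
qed

section \<open>Rainbow paths, partitions and color numberings\<close>

lemma contains_rainbow_tight_pathI:
  assumes "distinct [v1, v2, v3, v4, v5]"
    and "{v1, v2, v3} \<in> E" "{v2, v3, v4} \<in> E" "{v3, v4, v5} \<in> E"
    and "distinct [c {v1, v2, v3}, c {v2, v3, v4}, c {v3, v4, v5}]"
  shows "contains_rainbow_copy c E tight_path"
proof -
  \<comment> \<open>The vertices of \<open>tight_path\<close> are numbered from 1, list positions
    from 0.\<close>
  define f where "f i = [v1, v2, v3, v4, v5] ! (i - 1)" for i :: nat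
  have f: "f 1 = v1" "f 2 = v2" "f 3 = v3" "f 4 = v4" "f 5 = v5"
    by (simp_all add: f_def numeral_eq_Suc)
  let ?F = "{{v1, v2, v3}, {v2, v3, v4}, {v3, v4, v5}}"
  have "inj_on f (\<Union> tight_path)"
    using assms(1) f by (auto simp: tight_path_def inj_on_def)
  moreover have "?F = (`) f ` tight_path"
    using f by (simp add: tight_path_def)
  ultimately have "is_copy tight_path ?F" unfolding is_copy_def by blast
  moreover have "rainbow c ?F" using assms(5) unfolding rainbow_def by auto
  moreover have "?F \<subseteq> E" using assms by blast
  ultimately show ?thesis unfolding contains_rainbow_copy_def by blast
qed

text \<open>Everything left uncovered goes into the part \<open>i0\<close>, taken as the complement
  of the other \<open>T i\<close>; disjointness keeps \<open>T i0\<close> inside it.\<close>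

lemma indexed_partition_extend:
  assumes "i0 \<in> I" "disjoint_family_on T I" "\<And>i. i \<in> I \<Longrightarrow> T i \<noteq> {}" "\<And>i. i \<in> I \<Longrightarrow> T i \<subseteq> A"
  shows "\<exists>P. indexed_partition I P A \<and> (\<forall>i\<in>I. T i \<subseteq> P i)"
proof -
  define P where "P = T(i0 := A - (\<Union>i\<in>I - {i0}. T i))"
  have sub: "T i \<subseteq> P i" if "i \<in> I" for i
    using assms(1,2) assms(4)[OF that] that unfolding P_def disjoint_family_on_def by auto
  have "disjoint_family_on P I"
    using assms(2) unfolding P_def disjoint_family_on_def by auto
  moreover have "(\<Union>i\<in>I. P i) = A"
  proof
    show "(\<Union>i\<in>I. P i) \<subseteq> A" using assms(4) by (auto simp: P_def split: if_splits)
    show "A \<subseteq> (\<Union>i\<in>I. P i)" using assms(1) by (auto simp: P_def)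
  qed
  moreover have "\<forall>i\<in>I. P i \<noteq> {}" using sub assms(3) by blast
  ultimately show ?thesis using sub unfolding indexed_partition_def by blast
qed

lemma indexed_partition_fibers:
  assumes "bij_betw num I (g ` A)"
  shows "indexed_partition I (\<lambda>i. {x \<in> A. g x = num i}) A"
  unfolding indexed_partition_def
proof (intro conjI ballI)
  show "disjoint_family_on (\<lambda>i. {x \<in> A. g x = num i}) I"
    using bij_betw_imp_inj_on[OF assms] by (auto simp: disjoint_family_on_def inj_on_def)
  show "(\<Union>i\<in>I. {x \<in> A. g x = num i}) = A"
    using bij_betw_imp_surj_on[OF assms] by force
  show "{x \<in> A. g x = num i} \<noteq> {}" if "i \<in> I" for i
    using bij_betw_apply[OF assms that] by auto
qed

text \<open>Serves to give the separating color the number 1.\<close>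

lemma bij_betw_interval_with_first:
  fixes k :: nat
  assumes "finite S" "card S = k" "s \<in> S"
  shows "\<exists>num. bij_betw num {1..k} S \<and> num 1 = s"
proof -
  have k: "1 \<le> k" using assms card_gt_0_iff[of S] by force
  have "card {2..k} = card (S - {s})" using assms by simp
  then obtain h where h: "bij_betw h {2..k} (S - {s})"
    using finite_same_card_bij[of "{2..k}" "S - {s}"] assms(1) by auto
  have "bij_betw (h(1 := s)) {2..k} (S - {s})"
    using h by (subst bij_betw_cong[where g = h]) auto
  then have "bij_betw (h(1 := s)) ({2..k} \<union> {1}) ((S - {s}) \<union> {s})"
    by (intro bij_betw_combine) (auto simp: bij_betw_def)
  moreover have "{2..k} \<union> {1} = {1..k}" using k by auto
  moreover have "(S - {s}) \<union> {s} = S" using assms by auto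
  ultimately show ?thesis by (intro exI[of _ "h(1 := s)"]) simp
qed

theorem theorem1p13:
  fixes n k :: nat
    and V :: "nat \<Rightarrow> 'a set"
    and E :: "'a set set"
    and c :: "'a set \<Rightarrow> 'c"
  assumes "n \<ge> 3"
    and "disjoint_family_on V {1..3}"
    and "\<forall>l\<in>{1..3}. finite (V l) \<and> card (V l) = n"
    and "E = complete_3partite V"
    and "\<not> contains_rainbow_copy c E tight_path"
    and "k = card (colors_used c E)"
    and "k \<ge> 3"
  shows
    "(\<exists>l\<in>{1..3}. \<exists>(num :: nat \<Rightarrow> 'c) (P :: nat \<Rightarrow> 'a set).
        bij_betw num {1..k} (colors_used c E) \<and>
        indexed_partition {1..k} P (V l) \<and>
        (\<forall>i\<in>{1..k}. \<forall>e\<in>E. e \<inter> P i \<noteq> {} \<longrightarrow> c e = num i))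
     \<or>
     (\<exists>(num :: nat \<Rightarrow> 'c) (P :: nat \<Rightarrow> nat \<Rightarrow> 'a set).
        bij_betw num {1..k} (colors_used c E) \<and>
        (\<forall>l\<in>{1..3}. indexed_partition {2..k} (P l) (V l)) \<and>
        (\<forall>i\<in>{2..k}. \<forall>e\<in>E. e \<subseteq> P 1 i \<union> P 2 i \<union> P 3 i \<longrightarrow> c e \<in> {num 1, num i}) \<and>
        (\<forall>e\<in>E. (\<forall>i\<in>{2..k}. \<not> e \<subseteq> P 1 i \<union> P 2 i \<union> P 3 i) \<longrightarrow> c e = num 1))"
    (is "?rows \<or> ?blocks")
proof -

  \<comment> \<open>From the 3-graph to the cube\<close>
  define f where "f x y z = c {x, y, z}" for x y z
  define K where "K = {f x y z | x y z. x \<in> V 1 \<and> y \<in> V 2 \<and> z \<in> V 3}"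
  have K: "colors_used c E = K"
    unfolding colors_used_def assms(4) complete_3partite_def K_def f_def by blast
  \<comment> \<open>An infinite set has \<open>card\<close> 0, which \<open>k \<ge> 3\<close> rules
    out.\<close>
  have finK: "finite K" using assms(6,7) K card.infinite by fastforce
  have cardK: "card K = k" using assms(6) K by simp
  have E_iff: "e \<in> E \<longleftrightarrow> (\<exists>x\<in>V 1. \<exists>y\<in>V 2. \<exists>z\<in>V 3. e = {x, y, z})" for e
    unfolding assms(4) complete_3partite_def by blast
  have E: "{x, y, z} \<in> E" if "x \<in> V 1" "y \<in> V 2" "z \<in> V 3" for x y z
    using that E_iff by blast
  have disj: "V 1 \<inter> V 2 = {}" "V 1 \<inter> V 3 = {}" "V 2 \<inter> V 3 = {}"
    using assms(2) unfolding disjoint_family_on_def by simp_all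
  have V_ne: "V l \<noteq> {}" if "l \<in> {1..3}" for l
    using assms(1,3) that by fastforce
  have no_path: "\<not> distinct [c {v1, v2, v3}, c {v2, v3, v4}, c {v3, v4, v5}]"
    if "distinct [v1, v2, v3, v4, v5]"
      "{v1, v2, v3} \<in> E" "{v2, v3, v4} \<in> E" "{v3, v4, v5} \<in> E" for v1 v2 v3 v4 v5
    using contains_rainbow_tight_pathI[OF that] assms(5) by blast
  \<comment> \<open>The tight path is \<open>x', y, z, x, y'\<close>: its middle edge is the corner
    cell, and \<open>z\<close> lies on all three edges. For \<open>x = x'\<close> or
    \<open>y = y'\<close> two of the colors coincide.\<close>
  have corner: "\<not> distinct [c {x, y, z}, c {x', y, z}, c {x, y', z}]"
    if "{x, y, z} \<in> E" "{x', y, z} \<in> E" "{x, y', z} \<in> E"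
      "x \<noteq> y" "x \<noteq> y'" "x' \<noteq> y" "x' \<noteq> y'" "z \<notin> {x, x', y, y'}" for x x' y y' z
  proof (cases "x = x' \<or> y = y'")
    case False
    have eq: "{y, z, x} = {x, y, z}" "{z, x, y'} = {x, y', z}" by auto
    have "distinct [x', y, z, x, y']" using False that(4-8) by auto
    from no_path[OF this, unfolded eq] that(1-3)
    have "\<not> distinct [c {x', y, z}, c {x, y, z}, c {x, y', z}]" by blast
    then show ?thesis using distinct_length_2_or_more by metis
  qed auto
  have XY: "\<forall>z\<in>V 3. corner_free (V 1) (V 2) (\<lambda>x y. f x y z)"
    unfolding corner_free_def f_def
  proof (intro ballI)
    fix z x x' y y' assume "z \<in> V 3" "x \<in> V 1" "x' \<in> V 1" "y \<in> V 2" "y' \<in> V 2"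
    then show "\<not> distinct [c {x, y, z}, c {x', y, z}, c {x, y', z}]"
      using disj by (intro corner E) auto
  qed
  have XZ: "\<forall>y\<in>V 2. corner_free (V 1) (V 3) (\<lambda>x z. f x y z)"
    unfolding corner_free_def f_def
  proof (intro ballI)
    fix y x x' z z' assume h: "y \<in> V 2" "x \<in> V 1" "x' \<in> V 1" "z \<in> V 3" "z' \<in> V 3"
    \<comment> \<open>The fixed coordinate must stand last for \<open>corner\<close> to
      apply.\<close>
    have swap: "{u, y, w} = {u, w, y}" for u w by auto
    show "\<not> distinct [c {x, y, z}, c {x', y, z}, c {x, y, z'}]"
      unfolding swap using h disj by (intro corner E[of _ y, unfolded swap]) auto
  qed
  have YZ: "\<forall>x\<in>V 1. corner_free (V 2) (V 3) (f x)"
    unfolding corner_free_def f_def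
  proof (intro ballI)
    fix x y y' z z' assume h: "x \<in> V 1" "y \<in> V 2" "y' \<in> V 2" "z \<in> V 3" "z' \<in> V 3"
    have rot: "{x, v, w} = {v, w, x}" for v w by auto
    show "\<not> distinct [c {x, y, z}, c {x, y', z}, c {x, y, z'}]"
      unfolding rot using h disj by (intro corner E[of x, unfolded rot]) auto
  qed
  \<comment> \<open>All three cases of dependence on one coordinate end here, with the fibers of
    \<open>g\<close> as parts.\<close>
  have rows: ?rows
    if l: "l \<in> {1..3}" and g: "\<And>e v. \<lbrakk>e \<in> E; v \<in> e; v \<in> V l\<rbrakk> \<Longrightarrow> c e = g v"
      and Kg: "K = g ` V l" for l g
  proof -
    obtain num where num: "bij_betw num {1..k} K"
      using finK cardK finite_same_card_bij[of "{1..k}" K] by auto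
    have "indexed_partition {1..k} (\<lambda>i. {v \<in> V l. g v = num i}) (V l)"
      using indexed_partition_fibers num Kg by blast
    then show ?thesis using l g num unfolding K by (intro bexI[of _ l] exI) auto
  qed
  have "card {f x y z | x y z. x \<in> V 1 \<and> y \<in> V 2 \<and> z \<in> V 3} \<ge> 3"
    using cardK assms(7) unfolding K_def by simp
  from coloring_dichotomy[OF XY XZ YZ this] consider
      (fst) g where "\<forall>x\<in>V 1. \<forall>y\<in>V 2. \<forall>z\<in>V 3. f x y z = g x"
    | (snd) g where "\<forall>x\<in>V 1. \<forall>y\<in>V 2. \<forall>z\<in>V 3. f x y z = g y"
    | (thd) g where "\<forall>x\<in>V 1. \<forall>y\<in>V 2. \<forall>z\<in>V 3. f x y z = g z"
    | (separating) s where "s \<in> K" "separating (V 1) (V 2) (V 3) f s"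
    unfolding K_def[symmetric] .
  then show ?thesis
  proof cases
    case (fst g)
    have "c e = g v" if "e \<in> E" "v \<in> e" "v \<in> V 1" for e v
      using that fst disj unfolding E_iff f_def by blast
    moreover have "K = g ` V 1" using fst V_ne[of 2] V_ne[of 3] unfolding K_def by fastforce
    ultimately show ?thesis using rows[of 1 g] by simp
  next
    case (snd g)
    have "c e = g v" if "e \<in> E" "v \<in> e" "v \<in> V 2" for e v
      using that snd disj unfolding E_iff f_def by blast
    moreover have "K = g ` V 2" using snd V_ne[of 1] V_ne[of 3] unfolding K_def by fastforce
    ultimately show ?thesis using rows[of 2 g] by simp
  next
    case (thd g)
    have "c e = g v" if "e \<in> E" "v \<in> e" "v \<in> V 3" for e v
      using that thd disj unfolding E_iff f_def by blast
    moreover have "K = g ` V 3" using thd V_ne[of 1] V_ne[of 2] unfolding K_def by fastforce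
    ultimately show ?thesis using rows[of 3 g] by simp
  next

    \<comment> \<open>Alternative (ii): building the blocks\<close>
    case (separating s)
    obtain num where num: "bij_betw num {1..k} K" "num 1 = s"
      using bij_betw_interval_with_first[OF finK cardK separating(1)] by blast
    have num_inj: "num i \<noteq> num j" if "i \<in> {1..k}" "j \<in> {1..k}" "i \<noteq> j" for i j
      using inj_on_eq_iff[OF bij_betw_imp_inj_on[OF num(1)] that(1,2)] that(3) by blast
    \<comment> \<open>For \<open>i \<ge> 2\<close> these vertices are forced into part
      \<open>i\<close>.\<close>
    define T where "T l i = {v \<in> V l. \<exists>e\<in>E. v \<in> e \<and> c e = num i}" for l :: nat and i
    \<comment> \<open>As the partite sets are disjoint, a common vertex is a common coordinate, so
      \<open>separating\<close> applies. This makes the sets \<open>T l i\<close> with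
      \<open>i \<ge> 2\<close> disjoint.\<close>
    have share: "c e = c e'"
      if eE: "e \<in> E" "e' \<in> E" and ne: "c e \<noteq> s" "c e' \<noteq> s" and v: "v \<in> e" "v \<in> e'" for e e' v
    proof -
      obtain x y z where e: "x \<in> V 1" "y \<in> V 2" "z \<in> V 3" "e = {x, y, z}"
        using eE(1)[unfolded E_iff] by metis
      obtain x' y' z' where e': "x' \<in> V 1" "y' \<in> V 2" "z' \<in> V 3" "e' = {x', y', z'}"
        using eE(2)[unfolded E_iff] by metis
      have "x = x' \<or> y = y' \<or> z = z'"
        using v e(1-3) e'(1-3) disj unfolding e(4) e'(4) by auto
      then show ?thesis
        using separatingD[OF separating(2), of x x' y y' z z'] e(1-3) e'(1-3) ne
        unfolding f_def e(4) e'(4) by metis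
    qed
    \<comment> \<open>Vertices all of whose edges have color \<open>s\<close> are in no
      \<open>T l i\<close> with \<open>i \<ge> 2\<close>; they are put into part 2.\<close>
    have "\<exists>P. indexed_partition {2..k} P (V l) \<and> (\<forall>i\<in>{2..k}. T l i \<subseteq> P i)"
      if l: "l \<in> {1..3}" for l
    proof (rule indexed_partition_extend[of 2])
      show "disjoint_family_on (T l) {2..k}"
        unfolding disjoint_family_on_def
      proof (intro ballI impI)
        fix i j assume ij: "i \<in> {2..k}" "j \<in> {2..k}" "i \<noteq> j"
        then have "num i \<noteq> num j" "num i \<noteq> s" "num j \<noteq> s"
          using num_inj[of i j] num_inj[of i 1] num_inj[of j 1] num(2) by auto
        then have "\<not> (v \<in> T l i \<and> v \<in> T l j)" for v
          using share unfolding T_def mem_Collect_eq by metis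
        then show "T l i \<inter> T l j = {}" by blast
      qed
      show "T l i \<noteq> {}" if "i \<in> {2..k}" for i
      proof -
        have "num i \<in> K" using that bij_betw_apply[OF num(1), of i] by simp
        then obtain x y z where xyz: "x \<in> V 1" "y \<in> V 2" "z \<in> V 3" "c {x, y, z} = num i"
          unfolding K_def f_def by force
        have "l = 1 \<or> l = 2 \<or> l = 3" using l by auto
        moreover have "x \<in> V l \<Longrightarrow> x \<in> T l i" "y \<in> V l \<Longrightarrow> y \<in> T l i" "z \<in> V l \<Longrightarrow> z \<in> T l i"
          using E[OF xyz(1-3)] xyz(4) unfolding T_def by (auto intro!: bexI[of _ "{x, y, z}"])
        ultimately show ?thesis using xyz(1-3) by auto
      qed
    qed (use assms(7) in \<open>auto simp: T_def\<close>)
    then obtain P where P: "\<And>l. l \<in> {1..3} \<Longrightarrow> indexed_partition {2..k} (P l) (V l)"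
      and TP: "\<And>l i. \<lbrakk>l \<in> {1..3}; i \<in> {2..k}\<rbrakk> \<Longrightarrow> T l i \<subseteq> P l i"
      by metis
    have in_block: "\<exists>j\<in>{2..k}. c e = num j \<and> e \<subseteq> P 1 j \<union> P 2 j \<union> P 3 j"
      if "e \<in> E" "c e \<noteq> s" for e
    proof -
      have "c e \<in> K" using that(1) K unfolding colors_used_def by blast
      then obtain j where j: "j \<in> {1..k}" "c e = num j"
        using bij_betw_imp_surj_on[OF num(1)] by blast
      then have j2: "j \<in> {2..k}" using that(2) num(2) by (cases "j = 1") auto
      have "v \<in> T l j" if "v \<in> e" "v \<in> V l" for v l
        using that \<open>e \<in> E\<close> j(2) unfolding T_def by blast
      moreover have "e \<subseteq> V 1 \<union> V 2 \<union> V 3" using \<open>e \<in> E\<close> unfolding E_iff by auto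
      ultimately have "e \<subseteq> T 1 j \<union> T 2 j \<union> T 3 j" by blast
      also have "\<dots> \<subseteq> P 1 j \<union> P 2 j \<union> P 3 j" by (intro Un_mono TP j2) simp_all
      finally show ?thesis using j(2) j2 by blast
    qed
    \<comment> \<open>A color other than \<open>num 1\<close> and \<open>num i\<close> would place
      the edge in a second block \<open>j\<close> as well, and its vertex in \<open>V 1\<close>
      would lie in two disjoint parts.\<close>
    have block: "c e \<in> {num 1, num i}"
      if i: "i \<in> {2..k}" and e: "e \<in> E" "e \<subseteq> P 1 i \<union> P 2 i \<union> P 3 i" for i e
    proof (rule ccontr)
      assume ne: "c e \<notin> {num 1, num i}"
      then have "c e \<noteq> s" using num(2) by simp
      then obtain j where j: "j \<in> {2..k}" "c e = num j" "e \<subseteq> P 1 j \<union> P 2 j \<union> P 3 j"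
        using in_block[OF e(1)] by blast
      have sub: "P l m \<subseteq> V l" if "l \<in> {1..3}" "m \<in> {2..k}" for l m
        using P[OF that(1)] that(2) unfolding indexed_partition_def by blast
      have "i \<noteq> j" using ne j by auto
      then have dis: "P 1 i \<inter> P 1 j = {}"
        using P[of 1] i j(1) unfolding indexed_partition_def disjoint_family_on_def by simp
      obtain x where x: "x \<in> e" "x \<in> V 1" using e(1)[unfolded E_iff] by auto
      have "x \<in> P 1 m" if "m \<in> {2..k}" "e \<subseteq> P 1 m \<union> P 2 m \<union> P 3 m" for m
      proof -
        have "P 2 m \<subseteq> V 2" "P 3 m \<subseteq> V 3" using sub that(1) by simp_all
        then show ?thesis using x that(2) disj(1,2) by blast
      qed
      then show False using dis i j e(2) by blast
    qed
    have ?blocks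
    proof (intro exI conjI)
      show "bij_betw num {1..k} (colors_used c E)" using num K by simp
      show "\<forall>l\<in>{1..3}. indexed_partition {2..k} (P l) (V l)" using P by blast
      show "\<forall>i\<in>{2..k}. \<forall>e\<in>E. e \<subseteq> P 1 i \<union> P 2 i \<union> P 3 i \<longrightarrow> c e \<in> {num 1, num i}"
        using block by blast
      show "\<forall>e\<in>E. (\<forall>i\<in>{2..k}. \<not> e \<subseteq> P 1 i \<union> P 2 i \<union> P 3 i) \<longrightarrow> c e = num 1"
        using in_block unfolding num(2) by blast
    qed
    then show ?thesis by blast
  qed
qed

end
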